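(* Let $\phi=(\phi_\lambda,\phi_p)$ be the map defined for $\bm\gamma\in(\mathbb{R}\setminus\{0\})^n$ and $\bm u\in\mathbb{R}^{n-1}$ by $$\bm\lambda=\phi_\lambda(\bm\gamma,\bm u)=\bm\gamma^2,\qquad \bm p=\phi_p(\bm\gamma,\bm u)=\sigma(\bm u),$$ with the square and $\sigma$ applied elementwise. The image of $(\mathbb{R}\setminus\{0\})^n\times\mathbb{R}^{n-1}$ under $\phi$ is the set of valid Coxian distributions (of size $n$) in the Markovian representation. That is, $\phi$ maps the parametrization $(\bm\gamma,\bm u)$ onto the set of Coxian distributions in the Markovian representation.
   Context: The function $\sigma$ is the sigmoid, $\sigma(z)=1/(1+e^{-z})$. A Coxian distribution of size $n$ in the Markovian representation is given by parameters $(\bm\lambda,\bm p)$ with $\bm\lambda=(\lambda_1,\dots,\lambda_n)$, $\bm p=(p_1,\dots,p_{n-1})$, where $\lambda_j>0$ and $0\le p_j<1$ for all $j$. It is the phase type distribution (time to absorption of a continuous-time Markov chain) with initial probability vector $\bm\alpha=(1,0,\dots,0)$ and $n\times n$ subgenerator matrix $\bm T$ with $T_{jj}=-\lambda_j$ for $1\le j\le n$, $T_{j,j+1}=p_j\lambda_j$ for $1\le j\le n-1$, and all other entries $0$. *)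

theory Defs
  imports "HOL-Probability.Probability"
begin

text \<open>
  The construction of a continuous-time Markov chain on a finite state space \<open>I\<close> with
  generator \<open>Q\<close> and initial distribution \<open>\<nu>\<close> from its jump chain \<open>Y\<close> and its holding
  times \<open>S\<close>: \<open>Y\<close> is a discrete-time Markov chain with the jump matrix of \<open>Q\<close>, and
  conditionally on \<open>Y\<close> the holding times \<open>S k\<close> are independent and exponentially distributed
  with rate \<open>- Q (Y k) (Y k)\<close>. The holding time in a state of rate \<open>0\<close> is
  infinite; the real number \<open>S k\<close> carries no information there and is left unconstrained.
\<close>

definition jump_matrix :: "('s \<Rightarrow> 's \<Rightarrow> real) \<Rightarrow> 's \<Rightarrow> 's \<Rightarrow> real" where
  "jump_matrix Q i j =
     (if Q i i = 0 then (if j = i then 1 else 0)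
      else if j = i then 0 else Q i j / (- Q i i))"

definition ctmc ::
  "'w measure \<Rightarrow> 's set \<Rightarrow> ('s \<Rightarrow> real) \<Rightarrow> ('s \<Rightarrow> 's \<Rightarrow> real) \<Rightarrow>
    (nat \<Rightarrow> 'w \<Rightarrow> 's) \<Rightarrow> (nat \<Rightarrow> 'w \<Rightarrow> real) \<Rightarrow> bool" where
  "ctmc M I \<nu> Q Y S \<longleftrightarrow>
     prob_space M \<and>
     (\<forall>k. Y k \<in> M \<rightarrow>\<^sub>M count_space UNIV) \<and>
     (\<forall>k. S k \<in> borel_measurable M) \<and>
     (\<forall>m i s. (\<forall>k\<le>m. i k \<in> I \<and> 0 \<le> s k) \<longrightarrow>
        measure M {\<omega> \<in> space M. \<forall>k\<le>m. Y k \<omega> = i k \<and> (Q (i k) (i k) \<noteq> 0 \<longrightarrow> s k < S k \<omega>)}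
        = \<nu> (i 0) * (\<Prod>k<m. jump_matrix Q (i k) (i (Suc k)))
            * (\<Prod>k\<le>m. exp (Q (i k) (i k) * s k)))"

text \<open>
  The sum of the holding times before the first visit of the jump chain to the absorbing
  state \<open>a\<close>. Its value is arbitrary on paths that never reach \<open>a\<close>.
\<close>

definition absorption_time ::
  "'s \<Rightarrow> (nat \<Rightarrow> 'w \<Rightarrow> 's) \<Rightarrow> (nat \<Rightarrow> 'w \<Rightarrow> real) \<Rightarrow> 'w \<Rightarrow> real" where
  "absorption_time a Y S \<omega> = (\<Sum>k < (LEAST k. Y k \<omega> = a). S k \<omega>)"

text \<open>
  An initial vector \<open>\<alpha>\<close> and a subgenerator \<open>T\<close> of size \<open>n\<close> are indexed by the transient
  states \<open>{1..n}\<close>; the absorbing state is \<open>0\<close>. The full generator has block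
  form \<open>[[T, - T 1], [0, 0]]\<close>, and the full initial distribution is \<open>(\<alpha>, 1 - \<alpha> 1)\<close>.
\<close>

definition full_generator :: "nat \<Rightarrow> (nat \<Rightarrow> nat \<Rightarrow> real) \<Rightarrow> nat \<Rightarrow> nat \<Rightarrow> real" where
  "full_generator n T i j =
     (if i = 0 then 0 else if j = 0 then - (\<Sum>l = 1..n. T i l) else T i j)"

definition full_initial :: "nat \<Rightarrow> (nat \<Rightarrow> real) \<Rightarrow> nat \<Rightarrow> real" where
  "full_initial n \<alpha> j = (if j = 0 then 1 - (\<Sum>l = 1..n. \<alpha> l) else \<alpha> j)"

text \<open>
  The law of the absorption time does not depend on the sample space that carries the chain, so
  the latter is taken to be a probability measure on the type of pairs (jump path, holding times).
\<close>

definition phase_type ::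
  "nat \<Rightarrow> (nat \<Rightarrow> real) \<Rightarrow> (nat \<Rightarrow> nat \<Rightarrow> real) \<Rightarrow> real measure \<Rightarrow> bool" where
  "phase_type n \<alpha> T \<mu> \<longleftrightarrow>
     (\<exists>(M :: ((nat \<Rightarrow> nat) \<times> (nat \<Rightarrow> real)) measure) Y S.
        ctmc M {0..n} (full_initial n \<alpha>) (full_generator n T) Y S \<and>
        \<mu> = distr M borel (absorption_time 0 Y S))"

text \<open>
  Tuples are functions that are undefined outside their index set, in particular \<open>p n\<close> is \<open>undefined\<close>;
  it only enters the subgenerator in column \<open>Suc n\<close>, which is never used.
\<close>

definition coxian_parameters :: "nat \<Rightarrow> ((nat \<Rightarrow> real) \<times> (nat \<Rightarrow> real)) set" where
  "coxian_parameters n = ({1..n} \<rightarrow>\<^sub>E {0<..}) \<times> ({1..<n} \<rightarrow>\<^sub>E {0..<1})"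

definition coxian_initial :: "nat \<Rightarrow> real" where
  "coxian_initial j = (if j = 1 then 1 else 0)"

definition coxian_subgenerator ::
  "(nat \<Rightarrow> real) \<times> (nat \<Rightarrow> real) \<Rightarrow> nat \<Rightarrow> nat \<Rightarrow> real" where
  "coxian_subgenerator = (\<lambda>(l, p) i j.
     if j = i then - l i else if j = Suc i then p i * l i else 0)"

definition coxian_laws ::
  "nat \<Rightarrow> ((nat \<Rightarrow> real) \<times> (nat \<Rightarrow> real)) set \<Rightarrow> real measure set" where
  "coxian_laws n P =
     {\<mu>. \<exists>\<theta>\<in>P. phase_type n coxian_initial (coxian_subgenerator \<theta>) \<mu>}"

definition coxian_distributions :: "nat \<Rightarrow> real measure set" where
  "coxian_distributions n = coxian_laws n (coxian_parameters n)"

definition sigmoid :: "real \<Rightarrow> real" where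
  "sigmoid z = 1 / (1 + exp (- z))"

definition phi ::
  "nat \<Rightarrow> (nat \<Rightarrow> real) \<times> (nat \<Rightarrow> real) \<Rightarrow> (nat \<Rightarrow> real) \<times> (nat \<Rightarrow> real)" where
  "phi n = (\<lambda>(\<gamma>, u). (\<lambda>j\<in>{1..n}. (\<gamma> j)\<^sup>2, \<lambda>j\<in>{1..<n}. sigmoid (u j)))"

definition phi_domain :: "nat \<Rightarrow> ((nat \<Rightarrow> real) \<times> (nat \<Rightarrow> real)) set" where
  "phi_domain n = ({1..n} \<rightarrow>\<^sub>E (UNIV - {0})) \<times> ({1..<n} \<rightarrow>\<^sub>E UNIV)"

end

theory Submission
  imports Defs
begin

text \<open>
  The sigmoid misses the value \<open>0\<close>, so on parameters \<open>\<phi>\<close> reaches exactly the vectors with no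
  \<open>p\<^sub>j = 0\<close>. No law is lost. If \<open>p\<^sub>m = 0\<close> is the first zero, the chain never leaves the states
  \<open>1, \<dots>, m\<close>, and the last of them can be split in two: an independent exponential clock of the same
  rate \<open>c = \<lambda>\<^sub>m\<close> interrupts the holding time \<open>S\<close> in state \<open>m\<close> with probability \<open>1/2\<close>. The minimum of the clock
  and \<open>S\<close> is exponential of rate \<open>2c\<close>, and by lack of memory the residual time of an interrupted \<open>S\<close> is
  an independent exponential of rate \<open>c\<close>. This gives a chain of size \<open>m + 1\<close> with \<open>p\<^sub>m = 1/2\<close> and the same
  absorption time; repeating it leads to size \<open>n\<close>.
\<close>

section \<open>Jump matrix and jump paths of a Coxian generator\<close>

abbreviation coxian_generator ::
  "nat \<Rightarrow> (nat \<Rightarrow> real) \<Rightarrow> (nat \<Rightarrow> real) \<Rightarrow> nat \<Rightarrow> nat \<Rightarrow> real" where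
  "coxian_generator n l p \<equiv> full_generator n (coxian_subgenerator (l, p))"

text \<open>A Coxian chain started in state 1 can only move to the next state or be absorbed, so its
  whole jump path 1, ..., K, 0, 0, ... is determined by the number K of transient states
  visited.\<close>

definition coxian_path :: "nat \<Rightarrow> nat \<Rightarrow> nat" where
  "coxian_path K k = (if k < K then Suc k else 0)"

text \<open>The value \<open>0\<close> at \<open>j = n\<close> encodes the convention \<open>p\<^sub>n = 0\<close>.\<close>

definition reach_prob :: "nat \<Rightarrow> (nat \<Rightarrow> real) \<Rightarrow> nat \<Rightarrow> real" where
  "reach_prob n p j = (if j < n then \<Prod>k<j. p (Suc k) else 0)"

lemma coxian_generator_diag:
  "coxian_generator n l p i i = (if i = 0 then 0 else - l i)"
  by (simp add: full_generator_def coxian_subgenerator_def)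

lemma full_initial_coxian:
  assumes "1 \<le> n"
  shows "full_initial n coxian_initial j = (if j = 1 then 1 else 0)"
  using assms by (simp add: full_initial_def coxian_initial_def sum.delta)

lemma sum_coxian_subgenerator:
  assumes "i \<in> {1..n}"
  shows "(\<Sum>j = 1..n. coxian_subgenerator (l, p) i j) = - l i + (if i < n then p i * l i else 0)"
proof -
  have "coxian_subgenerator (l, p) i j =
      (if j = i then - l i else 0) + (if j = Suc i then p i * l i else 0)" for j
    by (simp add: coxian_subgenerator_def)
  then show ?thesis
    using assms by (simp add: sum.distrib sum.delta)
qed

lemma jump_matrix_coxian_Suc:
  assumes "0 < i" "0 < l i"
  shows "jump_matrix (coxian_generator n l p) i (Suc i) = p i"
  using assms by (simp add: jump_matrix_def full_generator_def coxian_subgenerator_def)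

lemma jump_matrix_coxian_0:
  assumes "i \<in> {1..n}" "0 < l i"
  shows "jump_matrix (coxian_generator n l p) i 0 = 1 - (if i < n then p i else 0)"
proof -
  have "coxian_generator n l p i 0 = l i - (if i < n then p i * l i else 0)"
    using assms sum_coxian_subgenerator[OF assms(1), of l p] by (simp add: full_generator_def)
  then show ?thesis
    using assms by (simp add: jump_matrix_def coxian_generator_diag divide_simps left_diff_distrib)
qed

lemma jump_matrix_coxian_00: "jump_matrix (coxian_generator n l p) 0 0 = 1"
  by (simp add: jump_matrix_def full_generator_def)

lemma jump_matrix_coxian_nonzero:
  assumes "jump_matrix (coxian_generator n l p) i j \<noteq> 0" "i \<noteq> 0 \<Longrightarrow> l i \<noteq> 0"
  shows "j = 0 \<or> i \<noteq> 0 \<and> j = Suc i"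
  using assms
  by (auto simp: jump_matrix_def full_generator_def coxian_subgenerator_def split: if_splits)

lemma prod_jump_matrix_coxian_path_prefix:
  assumes l: "\<And>i. i \<in> {1..n} \<Longrightarrow> 0 < l i" and "N < K" "K \<le> n"
  shows "(\<Prod>k<N. jump_matrix (coxian_generator n l p) (coxian_path K k) (coxian_path K (Suc k)))
    = (\<Prod>k<N. p (Suc k))"
  using assms by (intro prod.cong) (auto simp: coxian_path_def jump_matrix_coxian_Suc)

text \<open>The first r jumps contribute \<open>reach_prob n p r\<close>, the exit from state r + 1
  contributes 1 - p (Suc r), or 1 if r + 1 = n, and every later jump from 0 to 0 contributes 1.
  Writing the result as a difference lets the sum over r telescope in
  \<open>coxian_clock_if_ctmc\<close>.\<close>

lemma prod_jump_matrix_coxian_path: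
  assumes l: "\<And>i. i \<in> {1..n} \<Longrightarrow> 0 < l i" and "r < n" "r < N"
  shows "(\<Prod>k<N. jump_matrix (coxian_generator n l p)
      (coxian_path (Suc r) k) (coxian_path (Suc r) (Suc k)))
    = reach_prob n p r - reach_prob n p (Suc r)"
proof -
  let ?J = "\<lambda>k. jump_matrix (coxian_generator n l p) (coxian_path (Suc r) k) (coxian_path (Suc r) (Suc k))"
  have "Suc r \<le> N" using \<open>r < N\<close> by simp
  then show ?thesis
  proof (induction N rule: dec_induct)
    case base
    have "(\<Prod>k<r. ?J k) = (\<Prod>k<r. p (Suc k))"
      by (rule prod_jump_matrix_coxian_path_prefix) (use assms in auto)
    moreover have "?J r = 1 - (if Suc r < n then p (Suc r) else 0)"
      using assms by (simp add: coxian_path_def jump_matrix_coxian_0)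
    ultimately show ?case
      using \<open>r < n\<close> by (auto simp: reach_prob_def right_diff_distrib)
  next
    case (step N)
    then show ?case by (simp add: coxian_path_def jump_matrix_coxian_00)
  qed
qed

lemma prod_exp_coxian_path:
  assumes "K \<le> Suc N"
  shows "(\<Prod>k\<le>N. exp (coxian_generator n l p (coxian_path K k) (coxian_path K k) * s k))
    = (\<Prod>k<K. exp (- (l (Suc k) * s k)))"
proof (rule sym, rule prod.mono_neutral_cong_left)
  show "{..<K} \<subseteq> {..N}" using assms by auto
qed (auto simp: coxian_path_def coxian_generator_diag)

text \<open>Used in contrapositive form: a state sequence that is not the beginning of a Coxian path
  has an impossible initial state or an impossible jump, so the product formula of
  \<open>ctmc\<close> gives 0 for it.\<close>

lemma coxian_path_if_jumps:
  assumes l: "\<And>i. i \<in> {1..n} \<Longrightarrow> 0 < l i" and "1 \<le> n" "i 0 = 1" "\<And>k. k \<le> N \<Longrightarrow> i k \<le> n"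
    and "\<And>k. k < N \<Longrightarrow> jump_matrix (coxian_generator n l p) (i k) (i (Suc k)) \<noteq> 0"
  shows "\<exists>K\<in>{1..n}. \<forall>k\<le>N. i k = coxian_path K k"
  using assms(4,5)
proof (induction N)
  case 0
  then show ?case using assms(2,3) by (intro bexI[of _ n]) (auto simp: coxian_path_def)
next
  case (Suc N)
  then obtain K where K: "K \<in> {1..n}" "\<And>k. k \<le> N \<Longrightarrow> i k = coxian_path K k"
    by (metis le_SucI less_SucI)
  have bound: "i N \<le> n" "i (Suc N) \<le> n" using Suc.prems(1) by auto
  have jump: "i (Suc N) = 0 \<or> i N \<noteq> 0 \<and> i (Suc N) = Suc (i N)"
    using jump_matrix_coxian_nonzero[OF Suc.prems(2)[of N]] l[of "i N"] bound by fastforce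
  show ?case
  proof (cases "K \<le> N")
    case True
    then have "i (Suc N) = coxian_path K (Suc N)"
      using K(2)[of N] jump by (auto simp: coxian_path_def)
    with K show ?thesis by (metis le_Suc_eq)
  next
    \<comment> \<open>Without absorption up to step N, the induction hypothesis says only that K
      exceeds N. Hence K is chosen anew: N + 1 if the next jump is to 0, and N + 2
      otherwise.\<close>
    case False
    then have *: "\<And>k. k \<le> N \<Longrightarrow> i k = Suc k" using K by (auto simp: coxian_path_def)
    show ?thesis
    proof (cases "i (Suc N) = 0")
      case True
      then show ?thesis using * bound
        by (intro bexI[of _ "Suc N"]) (auto simp: coxian_path_def le_Suc_eq)
    next
      case False
      then show ?thesis using * bound jump
        by (intro bexI[of _ "Suc (Suc N)"]) (auto simp: coxian_path_def le_Suc_eq)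
    qed
  qed
qed

lemma Least_coxian_path: "(LEAST k. coxian_path K k = 0) = K"
  by (rule Least_equality) (auto simp: coxian_path_def split: if_splits)

text \<open>The condition \<open>K \<le> N\<close> puts the absorption step inside the observed
  window, so the prefix identifies the path. A shorter prefix would reveal only a lower bound on the
  number of visited states.\<close>

lemma coxian_path_eq_prefix_iff:
  assumes "0 < K" "K \<le> N"
  shows "(\<forall>k\<le>N. coxian_path K' k = coxian_path K k) \<longleftrightarrow> K' = K"
proof
  assume *: "\<forall>k\<le>N. coxian_path K' k = coxian_path K k"
  from *[rule_format, of K] assms have "K' \<le> K"
    by (simp add: coxian_path_def split: if_splits)
  moreover have "K \<le> K'"
    using *[rule_format, of "K - 1"] assms by (cases K) (auto simp: coxian_path_def split: if_splits)
  ultimately show "K' = K" by simp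
qed simp

section \<open>Equivalence of Coxian chains and clock descriptions\<close>

text \<open>
  A Coxian chain is described by the number \<open>K\<close> of transient states it visits and its holding times.
  Index \<open>k\<close> belongs to state \<open>k + 1\<close>.
\<close>

locale coxian_clock = prob_space M for M :: "'w measure" +
  fixes n :: nat and l p :: "nat \<Rightarrow> real" and K :: "'w \<Rightarrow> nat" and S :: "nat \<Rightarrow> 'w \<Rightarrow> real"
  assumes measurable_K [measurable]: "K \<in> M \<rightarrow>\<^sub>M count_space UNIV"
    and measurable_S [measurable]: "\<And>k. S k \<in> borel_measurable M"
    and AE_clock: "AE \<omega> in M. 0 < K \<omega> \<and> K \<omega> \<le> n \<and> (\<forall>k<K \<omega>. 0 < S k \<omega>)"
    and prob_clock: "\<And>j s. j < n \<Longrightarrow> (\<And>k. k \<le> j \<Longrightarrow> 0 \<le> s k) \<Longrightarrow>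
      prob {\<omega> \<in> space M. j < K \<omega> \<and> (\<forall>k\<le>j. s k < S k \<omega>)}
        = (\<Prod>k<j. p (Suc k)) * (\<Prod>k\<le>j. exp (- (l (Suc k) * s k)))"
begin

text \<open>The event for K = r + 1 is the event for r < K minus the event for r + 1 < K, with the
  same constraints on the holding times.\<close>

lemma prob_clock_eq_Suc:
  assumes "r < n" and s: "\<And>k. k \<le> r \<Longrightarrow> 0 \<le> s k"
  shows "prob {\<omega> \<in> space M. K \<omega> = Suc r \<and> (\<forall>k\<le>r. s k < S k \<omega>)}
    = (reach_prob n p r - reach_prob n p (Suc r)) * (\<Prod>k\<le>r. exp (- (l (Suc k) * s k)))"
proof -
  let ?A = "{\<omega> \<in> space M. r < K \<omega> \<and> (\<forall>k\<le>r. s k < S k \<omega>)}"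
  let ?B = "{\<omega> \<in> space M. Suc r < K \<omega> \<and> (\<forall>k\<le>r. s k < S k \<omega>)}"
  let ?e = "\<Prod>k\<le>r. exp (- (l (Suc k) * s k))"
  have A: "prob ?A = reach_prob n p r * ?e"
    using prob_clock[OF \<open>r < n\<close> s] \<open>r < n\<close> by (simp add: reach_prob_def)
  have B: "prob ?B = reach_prob n p (Suc r) * ?e"
  proof (cases "Suc r < n")
    case True
    \<comment> \<open>\<open>prob_clock\<close> at index r + 1 also constrains the holding time
      \<open>S (Suc r)\<close>. The threshold 0 makes this constraint void almost surely and its
      exponential factor equal to 1.\<close>
    let ?s = "s(Suc r := 0)"
    have "prob ?B = prob {\<omega> \<in> space M. Suc r < K \<omega> \<and> (\<forall>k\<le>Suc r. ?s k < S k \<omega>)}"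
    proof (rule finite_measure_eq_AE)
      show "AE \<omega> in M. \<omega> \<in> ?B \<longleftrightarrow>
          \<omega> \<in> {\<omega> \<in> space M. Suc r < K \<omega> \<and> (\<forall>k\<le>Suc r. ?s k < S k \<omega>)}"
        using AE_clock by eventually_elim (auto simp: le_Suc_eq)
    qed measurable
    also have "\<dots> = (\<Prod>k<Suc r. p (Suc k)) * (\<Prod>k\<le>Suc r. exp (- (l (Suc k) * ?s k)))"
      using True s by (intro prob_clock) auto
    also have "(\<Prod>k\<le>Suc r. exp (- (l (Suc k) * ?s k))) = ?e"
      by (auto simp: intro!: prod.cong)
    finally show ?thesis using True by (simp add: reach_prob_def)
  next
    case False
    have "prob ?B = prob {}"
    proof (rule finite_measure_eq_AE)
      show "AE \<omega> in M. \<omega> \<in> ?B \<longleftrightarrow> \<omega> \<in> {}"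
        using AE_clock by eventually_elim (use False in auto)
    qed measurable
    then show ?thesis using False by (simp add: reach_prob_def)
  qed
  have "{\<omega> \<in> space M. K \<omega> = Suc r \<and> (\<forall>k\<le>r. s k < S k \<omega>)} = ?A - ?B" by auto
  moreover have "prob (?A - ?B) = prob ?A - prob ?B"
    by (rule finite_measure_Diff) (measurable, auto)
  ultimately show ?thesis
    by (simp only: A B left_diff_distrib)
qed

text \<open>The product formula has to hold for every state sequence i. A prefix of a path that is
  not yet absorbed at step N corresponds to the event N < K, a prefix containing the absorption to K
  = r + 1, and for all other sequences both sides are 0.\<close>

lemma ctmc_coxian_path:
  assumes l: "\<And>i. i \<in> {1..n} \<Longrightarrow> 0 < l i" and "1 \<le> n"
  shows "ctmc M {0..n} (full_initial n coxian_initial) (coxian_generator n l p)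
    (\<lambda>k \<omega>. coxian_path (K \<omega>) k) S"
proof -
  let ?Q = "coxian_generator n l p"
  have "prob {\<omega> \<in> space M. \<forall>k\<le>N. coxian_path (K \<omega>) k = i k \<and> (?Q (i k) (i k) \<noteq> 0 \<longrightarrow> s k < S k \<omega>)}
      = full_initial n coxian_initial (i 0) * (\<Prod>k<N. jump_matrix ?Q (i k) (i (Suc k)))
        * (\<Prod>k\<le>N. exp (?Q (i k) (i k) * s k))" (is "prob ?E = ?R")
    if that: "\<And>k. k \<le> N \<Longrightarrow> i k \<in> {0..n}" "\<And>k. k \<le> N \<Longrightarrow> 0 \<le> s k" for N i s
  proof (cases "\<exists>K\<in>{1..n}. \<forall>k\<le>N. i k = coxian_path K k")
    case True
    then obtain K0 where K0: "K0 \<in> {1..n}" and i: "\<And>k. k \<le> N \<Longrightarrow> i k = coxian_path K0 k"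
      by blast
    have Q: "?Q (coxian_path K0 k) (coxian_path K0 k) \<noteq> 0 \<longleftrightarrow> k < K0" for k
      using l[of "Suc k"] K0 by (auto simp: coxian_path_def coxian_generator_diag)
    have E: "?E = {\<omega> \<in> space M. (\<forall>k\<le>N. coxian_path (K \<omega>) k = coxian_path K0 k) \<and>
        (\<forall>k\<le>N. k < K0 \<longrightarrow> s k < S k \<omega>)}"
      using i Q by auto
    have R: "?R = (\<Prod>k<N. jump_matrix ?Q (coxian_path K0 k) (coxian_path K0 (Suc k)))
        * (\<Prod>k\<le>N. exp (?Q (coxian_path K0 k) (coxian_path K0 k) * s k))"
      using i K0 \<open>1 \<le> n\<close> by (simp add: full_initial_coxian coxian_path_def)
    show ?thesis
    proof (cases "N < K0")
      case True
      have "?E = {\<omega> \<in> space M. N < K \<omega> \<and> (\<forall>k\<le>N. s k < S k \<omega>)}"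
      proof -
        have "(\<forall>k\<le>N. coxian_path (K \<omega>) k = coxian_path K0 k) \<longleftrightarrow> N < K \<omega>" for \<omega>
          using True by (auto simp: coxian_path_def)
        then show ?thesis unfolding E using True by auto
      qed
      moreover have "(\<Prod>k\<le>N. exp (?Q (coxian_path K0 k) (coxian_path K0 k) * s k))
          = (\<Prod>k\<le>N. exp (- (l (Suc k) * s k)))"
        using True by (intro prod.cong) (auto simp: coxian_path_def coxian_generator_diag)
      ultimately show ?thesis
        unfolding R using prod_jump_matrix_coxian_path_prefix[OF l True] prob_clock[of N s] that(2) K0 True
        by simp
    next
      case False
      then obtain r where r: "K0 = Suc r" "r < N" "r < n" using K0 by (cases K0) auto
      have "?E = {\<omega> \<in> space M. K \<omega> = Suc r \<and> (\<forall>k\<le>r. s k < S k \<omega>)}"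
        unfolding E using r by (subst coxian_path_eq_prefix_iff) auto
      then show ?thesis
        unfolding R using r prob_clock_eq_Suc[of r s] that(2) prod_jump_matrix_coxian_path[OF l, where r = r and N = N and p = p]
        by (simp add: prod_exp_coxian_path lessThan_Suc_atMost)
    qed
  next
    case False
    have "?R = 0"
    proof (rule ccontr)
      assume "?R \<noteq> 0"
      then have "i 0 = 1" "\<And>k. k < N \<Longrightarrow> jump_matrix ?Q (i k) (i (Suc k)) \<noteq> 0"
        using \<open>1 \<le> n\<close> by (auto simp: full_initial_coxian split: if_splits)
      with coxian_path_if_jumps[OF l \<open>1 \<le> n\<close>, where i = i and N = N and p = p] that False show False by auto
    qed
    moreover have "prob ?E = prob {}"
    proof (rule finite_measure_eq_AE)
      show "AE \<omega> in M. \<omega> \<in> ?E \<longleftrightarrow> \<omega> \<in> {}"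
        using AE_clock
      proof eventually_elim
        case (elim \<omega>)
        then have "K \<omega> \<in> {1..n}" by auto
        with False obtain k where "k \<le> N" "i k \<noteq> coxian_path (K \<omega>) k" by blast
        then show ?case by auto
      qed
    qed measurable
    ultimately show ?thesis by simp
  qed
  then show ?thesis
    unfolding ctmc_def using prob_space_axioms by auto
qed

end

text \<open>The probabilities of being absorbed after exactly r + 1 transient states, summed over r
  < m, telescope to 1, because \<open>reach_prob n p m\<close> vanishes: either m = n or the factor
  p m is 0. So almost surely the jump chain follows one of m paths, and a zero p m reduces the size
  from n to m.\<close>

lemma coxian_clock_if_ctmc:
  fixes M :: "'w measure"
  assumes ctmc: "ctmc M {0..n} (full_initial n coxian_initial) (coxian_generator n l p) Y S"
    and l: "\<And>i. i \<in> {1..n} \<Longrightarrow> 0 < l i" and "1 \<le> m" "m \<le> n" and m: "m < n \<Longrightarrow> p m = 0"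
  shows "coxian_clock M m l p (\<lambda>\<omega>. LEAST k. Y k \<omega> = 0) S"
proof -
  let ?Q = "coxian_generator n l p"
  have prob_space: "prob_space M"
    and Y [measurable]: "\<And>k. Y k \<in> M \<rightarrow>\<^sub>M count_space UNIV"
    and S [measurable]: "\<And>k. S k \<in> borel_measurable M"
    and formula: "\<And>N i s. (\<And>k. k \<le> N \<Longrightarrow> i k \<in> {0..n} \<and> 0 \<le> s k) \<Longrightarrow>
      measure M {\<omega> \<in> space M. \<forall>k\<le>N. Y k \<omega> = i k \<and> (?Q (i k) (i k) \<noteq> 0 \<longrightarrow> s k < S k \<omega>)}
        = full_initial n coxian_initial (i 0) * (\<Prod>k<N. jump_matrix ?Q (i k) (i (Suc k)))
          * (\<Prod>k\<le>N. exp (?Q (i k) (i k) * s k))"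
    using ctmc unfolding ctmc_def by auto
  interpret prob_space M by fact
  have path_prob:
    "prob {\<omega> \<in> space M. \<forall>k\<le>N. Y k \<omega> = coxian_path K0 k \<and> (k < K0 \<longrightarrow> s k < S k \<omega>)}
      = (\<Prod>k<N. jump_matrix ?Q (coxian_path K0 k) (coxian_path K0 (Suc k)))
        * (\<Prod>k\<le>N. exp (?Q (coxian_path K0 k) (coxian_path K0 k) * s k))"
    if "K0 \<in> {1..n}" "\<And>k. k \<le> N \<Longrightarrow> 0 \<le> s k" for N K0 s
  proof -
    have Q: "?Q (coxian_path K0 k) (coxian_path K0 k) \<noteq> 0 \<longleftrightarrow> k < K0" for k
      using l[of "Suc k"] that by (auto simp: coxian_path_def coxian_generator_diag)
    show ?thesis
      using formula[of N "coxian_path K0" s] that unfolding Q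
      by (auto simp: full_initial_coxian coxian_path_def)
  qed
  \<comment> \<open>With all thresholds equal to 0 the exponential factors are 1, so requiring
    positive holding times costs no probability. Their almost sure positivity is thus obtained
    together with the shape of the path.\<close>
  define B where "B N r = {\<omega> \<in> space M. \<forall>k\<le>N. Y k \<omega> = coxian_path (Suc r) k
    \<and> (k < Suc r \<longrightarrow> 0 < S k \<omega>)}" for N r
  have [measurable]: "B N r \<in> sets M" for N r unfolding B_def by measurable
  have "AE \<omega> in M. \<exists>r<m. \<omega> \<in> B N r" if "m \<le> N" for N
  proof -
    have "disjoint_family_on (B N) {..<m}"
      unfolding disjoint_family_on_def
    proof (intro ballI impI)
      fix r r' assume "r \<in> {..<m}" "r' \<in> {..<m}" "r \<noteq> r'"
      then show "B N r \<inter> B N r' = {}"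
        using coxian_path_eq_prefix_iff[of "Suc r'" N "Suc r"] \<open>m \<le> N\<close> by (auto simp: B_def)
    qed
    then have "prob (\<Union>r<m. B N r) = (\<Sum>r<m. prob (B N r))"
      by (intro finite_measure_finite_Union) auto
    also have "\<dots> = (\<Sum>r<m. reach_prob n p r - reach_prob n p (Suc r))"
    proof (rule sum.cong)
      fix r assume "r \<in> {..<m}"
      then show "prob (B N r) = reach_prob n p r - reach_prob n p (Suc r)"
        unfolding B_def using path_prob[of "Suc r" N "\<lambda>_. 0"] \<open>m \<le> n\<close> \<open>m \<le> N\<close>
        prod_jump_matrix_coxian_path[OF l, where r = r and N = N and p = p] \<open>r \<in> {..<m}\<close> prod_exp_coxian_path[of "Suc r" N n l p "\<lambda>_. 0"]
        by simp
    qed simp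
    also have "\<dots> = reach_prob n p 0 - reach_prob n p m"
      by (rule sum_lessThan_telescope')
    also have "reach_prob n p m = 0"
    proof (cases "m < n")
      case True
      then show ?thesis using m \<open>1 \<le> m\<close>
        by (auto simp: reach_prob_def intro!: bexI[of _ "m - 1"])
    qed (simp add: reach_prob_def)
    also have "reach_prob n p 0 = 1" using \<open>1 \<le> m\<close> \<open>m \<le> n\<close> by (simp add: reach_prob_def)
    finally have "AE \<omega> in M. \<omega> \<in> (\<Union>r<m. B N r)" by (intro AE_prob_1) simp
    then show ?thesis by eventually_elim auto
  qed
  then have "AE \<omega> in M. \<forall>N. m \<le> N \<longrightarrow> (\<exists>r<m. \<omega> \<in> B N r)"
    by (simp add: AE_all_countable)
  then have path: "AE \<omega> in M. \<exists>K\<in>{1..m}. \<forall>k. Y k \<omega> = coxian_path K k \<and> (k < K \<longrightarrow> 0 < S k \<omega>)"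
  proof eventually_elim
    case (elim \<omega>)
    then obtain r where r: "r < m" "\<omega> \<in> B m r" by blast
    \<comment> \<open>So far the index r may depend on the length of the prefix. Since r < m, the
      prefix up to m already contains the absorption, which forces the same r for all longer
      prefixes.\<close>
    have "Y k \<omega> = coxian_path (Suc r) k \<and> (k < Suc r \<longrightarrow> 0 < S k \<omega>)" for k
    proof -
      obtain r' where r': "r' < m" "\<omega> \<in> B (max m k) r'" using elim by (meson max.cobounded1)
      have "Suc r' = Suc r"
        using coxian_path_eq_prefix_iff[of "Suc r" m "Suc r'"] r r' by (auto simp: B_def)
      with r' show ?thesis by (auto simp: B_def)
    qed
    with r show ?case by (intro bexI[of _ "Suc r"]) auto
  qed
  show ?thesis
  proof unfold_locales
    show "(\<lambda>\<omega>. LEAST k. Y k \<omega> = 0) \<in> M \<rightarrow>\<^sub>M count_space UNIV" by measurable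
    show "S k \<in> borel_measurable M" for k by measurable
    show "AE \<omega> in M. 0 < (LEAST k. Y k \<omega> = 0) \<and> (LEAST k. Y k \<omega> = 0) \<le> m \<and>
        (\<forall>k<LEAST k. Y k \<omega> = 0. 0 < S k \<omega>)"
      using path by eventually_elim (auto simp: Least_coxian_path)
  next
    fix j and s :: "nat \<Rightarrow> real"
    assume j: "j < m" and s: "\<And>k. k \<le> j \<Longrightarrow> 0 \<le> s k"
    \<comment> \<open>Because j < m, all paths with more than j transient states agree up to step j,
      and \<open>coxian_path m\<close> serves as their representative.\<close>
    have "prob {\<omega> \<in> space M. j < (LEAST k. Y k \<omega> = 0) \<and> (\<forall>k\<le>j. s k < S k \<omega>)}
      = prob {\<omega> \<in> space M. \<forall>k\<le>j. Y k \<omega> = coxian_path m k \<and> (k < m \<longrightarrow> s k < S k \<omega>)}"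
    proof (rule finite_measure_eq_AE)
      show "AE \<omega> in M. \<omega> \<in> {\<omega> \<in> space M. j < (LEAST k. Y k \<omega> = 0) \<and> (\<forall>k\<le>j. s k < S k \<omega>)} \<longleftrightarrow>
        \<omega> \<in> {\<omega> \<in> space M. \<forall>k\<le>j. Y k \<omega> = coxian_path m k \<and> (k < m \<longrightarrow> s k < S k \<omega>)}"
        using path
      proof eventually_elim
        case (elim \<omega>)
        then obtain K where K: "\<And>k. Y k \<omega> = coxian_path K k" by blast
        have "(\<forall>k\<le>j. coxian_path K k = coxian_path m k) \<longleftrightarrow> j < K"
          using j by (auto simp: coxian_path_def)
        then show ?case using j by (auto simp: K Least_coxian_path)
      qed
    qed measurable
    also have "\<dots> = (\<Prod>k<j. p (Suc k)) * (\<Prod>k\<le>j. exp (- (l (Suc k) * s k)))"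
    proof -
      have "(\<Prod>k\<le>j. exp (?Q (coxian_path m k) (coxian_path m k) * s k))
          = (\<Prod>k\<le>j. exp (- (l (Suc k) * s k)))"
        using j by (intro prod.cong) (auto simp: coxian_path_def coxian_generator_diag)
      then show ?thesis
        using path_prob[of m j s] prod_jump_matrix_coxian_path_prefix[OF l j] s \<open>1 \<le> m\<close> \<open>m \<le> n\<close>
        by simp
    qed
    finally show "prob {\<omega> \<in> space M. j < (LEAST k. Y k \<omega> = 0) \<and> (\<forall>k\<le>j. s k < S k \<omega>)}
      = (\<Prod>k<j. p (Suc k)) * (\<Prod>k\<le>j. exp (- (l (Suc k) * s k)))" .
  qed
qed

section \<open>Exponential clocks and the splitting of the last state\<close>

definition exponential :: "real \<Rightarrow> real measure" where
  "exponential c = density lborel (exponential_density c)"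

lemma sets_exponential [measurable_cong, simp]: "sets (exponential c) = sets borel"
  by (simp add: exponential_def)

lemma space_exponential [simp]: "space (exponential c) = UNIV"
  by (simp add: exponential_def)

lemma prob_space_exponential: "0 < c \<Longrightarrow> prob_space (exponential c)"
  unfolding exponential_def by (rule prob_space_exponential_density)

lemma emeasure_exponential_greaterThan:
  assumes "0 < c" "0 \<le> a"
  shows "emeasure (exponential c) {a<..} = ennreal (exp (- (c * a)))"
proof -
  interpret prob_space "exponential c" using assms by (simp add: prob_space_exponential)
  have "distributed (exponential c) lborel (\<lambda>x. x) (exponential_density c)"
    by (simp add: distributed_def exponential_def distr_id2)
  from exponential_distributedD_gt[OF this] assms have "prob {a<..} = exp (- (c * a))"
    by (simp add: greaterThan_def mult.commute)
  then show ?thesis by (simp add: emeasure_eq_measure)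
qed

lemma AE_exponential_pos: "AE u in exponential c. 0 < u"
proof -
  have "AE x in lborel. x \<noteq> (0::real)" by (rule AE_lborel_singleton)
  then have "AE x in lborel. 0 < ennreal (exponential_density c x) \<longrightarrow> 0 < x"
    by eventually_elim (auto simp: exponential_density_def split: if_splits)
  then show ?thesis unfolding exponential_def by (subst AE_density) auto
qed

text \<open>For a fixed clock value u > 0, the density c exp(-cu) times the tail A exp(-c(u + b))
  equals A/2 exp(-cb) times the density of rate 2c. Integrating over u > a gives the claim: the
  factor 1/2 is the chance that the clock rings first, and b bounds the residual time. The predicate
  P carries the history of the chain before the race.\<close>

lemma (in prob_space) emeasure_exponential_race:
  assumes [measurable]: "Measurable.pred M P" "X \<in> borel_measurable M"
    and c: "0 < c" and "0 \<le> a" "0 \<le> b"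
    and tail: "\<And>t. 0 \<le> t \<Longrightarrow> prob {\<omega> \<in> space M. P \<omega> \<and> t < X \<omega>} = A * exp (- (c * t))"
  shows "emeasure (M \<Otimes>\<^sub>M exponential c)
      {z \<in> space (M \<Otimes>\<^sub>M exponential c). a < snd z \<and> P (fst z) \<and> snd z + b < X (fst z)}
    = ennreal (A / 2 * exp (- (c * b)) * exp (- (2 * c * a)))" (is "emeasure ?N ?E = _")
proof -
  interpret E: prob_space "exponential c" using c by (rule prob_space_exponential)
  interpret N: pair_prob_space M "exponential c" ..
  have A: "0 \<le> A" using tail[of 0] by (metis measure_nonneg mult_1_right exp_zero mult_zero_right neg_equal_0_iff_equal order_refl)
  have "emeasure ?N ?E = (\<integral>\<^sup>+u. emeasure M ((\<lambda>\<omega>. (\<omega>, u)) -` ?E) \<partial>exponential c)"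
    by (rule N.emeasure_pair_measure_alt2) measurable
  also have "\<dots> = (\<integral>\<^sup>+u. indicator {a<..} u * ennreal (A * exp (- (c * (u + b)))) \<partial>exponential c)"
  proof (rule nn_integral_cong)
    fix u :: real
    have "(\<lambda>\<omega>. (\<omega>, u)) -` ?E = (if a < u then {\<omega> \<in> space M. P \<omega> \<and> u + b < X \<omega>} else {})"
      by (auto simp: space_pair_measure)
    then show "emeasure M ((\<lambda>\<omega>. (\<omega>, u)) -` ?E) = indicator {a<..} u * ennreal (A * exp (- (c * (u + b))))"
      using tail[of "u + b"] assms by (simp add: emeasure_eq_measure)
  qed
  also have "\<dots> = (\<integral>\<^sup>+u. ennreal (A / 2 * exp (- (c * b))) * 
      (ennreal (exponential_density (2 * c) u) * indicator {a<..} u) \<partial>lborel)"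
    unfolding exponential_def
  proof (subst nn_integral_density)
    show "(\<integral>\<^sup>+u. ennreal (exponential_density c u) * (indicator {a<..} u * ennreal (A * exp (- (c * (u + b))))) \<partial>lborel)
      = (\<integral>\<^sup>+u. ennreal (A / 2 * exp (- (c * b))) * 
      (ennreal (exponential_density (2 * c) u) * indicator {a<..} u) \<partial>lborel)"
    proof (rule nn_integral_cong)
      fix u :: real
      have "exponential_density c u * (A * exp (- (c * (u + b))))
        = A / 2 * exp (- (c * b)) * exponential_density (2 * c) u"
        by (auto simp: exponential_density_def algebra_simps simp flip: exp_add)
      then show "ennreal (exponential_density c u) * (indicator {a<..} u * ennreal (A * exp (- (c * (u + b)))))
        = ennreal (A / 2 * exp (- (c * b))) * (ennreal (exponential_density (2 * c) u) * indicator {a<..} u)"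
        using A c by (auto simp: indicator_def exponential_density_nonneg simp flip: ennreal_mult)
    qed
  qed auto
  also have "\<dots> = ennreal (A / 2 * exp (- (c * b))) * emeasure (exponential (2 * c)) {a<..}"
    unfolding exponential_def by (subst nn_integral_cmult) (auto simp: emeasure_density)
  also have "\<dots> = ennreal (A / 2 * exp (- (c * b)) * exp (- (2 * c * a)))"
    using A c \<open>0 \<le> a\<close>
    by (simp add: emeasure_exponential_greaterThan del: times_divide_eq_left flip: ennreal_mult'')
  finally show ?thesis .
qed

context coxian_clock
begin

definition total :: "'w \<Rightarrow> real" where
  "total = (\<lambda>\<omega>. \<Sum>k<K \<omega>. S k \<omega>)"

lemma measurable_total [measurable]: "total \<in> borel_measurable M"
  unfolding total_def
  by (rule measurable_compose_countable[where f = "\<lambda>i \<omega>. \<Sum>k<i. S k \<omega>" and g = K]) measurable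

end

text \<open>The second coordinate of the enlarged sample space is the independent interrupting
  clock. The joint tails are checked by the last visited index j: below r the clock is invisible, at
  r the minimum matters, and at r + 1 the race does. The total time is preserved because minimum and
  residual add up to the original holding time.\<close>

lemma coxian_clock_split:
  fixes M :: "'w measure"
  assumes clock: "coxian_clock M (Suc r) l p K S" and c: "0 < l (Suc r)"
    and p: "\<And>k. k < r \<Longrightarrow> 0 \<le> p (Suc k)"
  defines "N \<equiv> M \<Otimes>\<^sub>M exponential (l (Suc r))"
    and "l' \<equiv> l(Suc r := 2 * l (Suc r), Suc (Suc r) := l (Suc r))"
    and "p' \<equiv> p(Suc r := 1 / 2)"
  shows "\<exists>K' S'. coxian_clock N (Suc (Suc r)) l' p' K' S' \<and>
    distr N borel (\<lambda>z. \<Sum>k<K' z. S' k z) = distr M borel (\<lambda>\<omega>. \<Sum>k<K \<omega>. S k \<omega>)"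
proof -
  interpret coxian_clock M "Suc r" l p K S by fact
  let ?c = "l (Suc r)"
  interpret E: prob_space "exponential ?c" using c by (rule prob_space_exponential)
  interpret N: pair_prob_space M "exponential ?c" ..
  \<comment> \<open>Index r belongs to the last state r + 1. If the clock rings before
    \<open>S r\<close> is over, the extra state r + 2 is visited for the residual time; otherwise
    the minimum is \<open>S r\<close> itself.\<close>
  define K' :: "'w \<times> real \<Rightarrow> nat" where "K' z = (if r < K (fst z)
    then if snd z < S r (fst z) then Suc (Suc r) else Suc r else K (fst z))" for z
  define S' :: "nat \<Rightarrow> 'w \<times> real \<Rightarrow> real" where "S' k z = (if k = r then min (S r (fst z)) (snd z)
    else if k = Suc r then S r (fst z) - snd z else S k (fst z))" for k z
  have [measurable]: "K' \<in> N \<rightarrow>\<^sub>M count_space UNIV" unfolding K'_def N_def by measurable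
  have [measurable]: "S' k \<in> borel_measurable N" for k
    unfolding S'_def N_def by measurable
  have AE_fst: "AE z in N. 0 < K (fst z) \<and> K (fst z) \<le> Suc r \<and> (\<forall>k<K (fst z). 0 < S k (fst z))"
  proof (rule AE_distrD[where M' = M and P = "\<lambda>\<omega>. 0 < K \<omega> \<and> K \<omega> \<le> Suc r \<and> (\<forall>k<K \<omega>. 0 < S k \<omega>)"])
    show "fst \<in> N \<rightarrow>\<^sub>M M" unfolding N_def by measurable
    show "AE \<omega> in distr N M fst. 0 < K \<omega> \<and> K \<omega> \<le> Suc r \<and> (\<forall>k<K \<omega>. 0 < S k \<omega>)"
      unfolding N_def E.distr_pair_fst by (rule AE_clock)
  qed
  have AE_snd: "AE z in N. 0 < snd z"
    unfolding N_def
  proof (rule N.AE_pair_measure)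
    show "AE x in M. AE u in exponential ?c. 0 < snd (x, u)"
      using AE_exponential_pos by simp
  qed measurable
  have "coxian_clock N (Suc (Suc r)) l' p' K' S'"
  proof (intro coxian_clock.intro coxian_clock_axioms.intro)
    show "prob_space N" unfolding N_def by unfold_locales
    show "AE z in N. 0 < K' z \<and> K' z \<le> Suc (Suc r) \<and> (\<forall>k<K' z. 0 < S' k z)"
      using AE_fst AE_snd
      by eventually_elim (auto simp: K'_def S'_def less_Suc_eq)
  next
    fix j and s :: "nat \<Rightarrow> real"
    assume j: "j < Suc (Suc r)" and s: "\<And>k. k \<le> j \<Longrightarrow> 0 \<le> s k"
    let ?E = "{z \<in> space N. j < K' z \<and> (\<forall>k\<le>j. s k < S' k z)}"
    consider "j < r" | "j = r" | "j = Suc r" using j by linarith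
    then have "emeasure N ?E = ennreal ((\<Prod>k<j. p' (Suc k)) * (\<Prod>k\<le>j. exp (- (l' (Suc k) * s k))))"
    proof cases
      case 1
      have "?E = {\<omega> \<in> space M. j < K \<omega> \<and> (\<forall>k\<le>j. s k < S k \<omega>)} \<times> space (exponential ?c)"
        using 1 by (auto simp: N_def space_pair_measure K'_def S'_def)
      moreover have sets: "{\<omega> \<in> space M. j < K \<omega> \<and> (\<forall>k\<le>j. s k < S k \<omega>)} \<in> events"
        by measurable
      ultimately have "emeasure N ?E = emeasure M {\<omega> \<in> space M. j < K \<omega> \<and> (\<forall>k\<le>j. s k < S k \<omega>)}"
        unfolding N_def by (simp only: E.emeasure_pair_measure_Times[OF sets sets.top] E.emeasure_space_1 mult_1_right)
      then show ?thesis
        using 1 s prob_clock[of j s] by (simp add: emeasure_eq_measure l'_def p'_def)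
    next
      case 2
      \<comment> \<open>The minimum exceeds \<open>s r\<close> exactly if both the holding time and
        the clock do. The two survival factors combine to rate 2c.\<close>
      have "?E = {\<omega> \<in> space M. r < K \<omega> \<and> (\<forall>k\<le>r. s k < S k \<omega>)} \<times> {s r<..}"
        using 2 by (auto simp: N_def space_pair_measure K'_def S'_def)
      then have "emeasure N ?E = emeasure M {\<omega> \<in> space M. r < K \<omega> \<and> (\<forall>k\<le>r. s k < S k \<omega>)}
          * emeasure (exponential ?c) {s r<..}"
        unfolding N_def by (simp add: E.emeasure_pair_measure_Times)
      also have "\<dots> = ennreal ((\<Prod>k<r. p (Suc k)) * (\<Prod>k\<le>r. exp (- (l (Suc k) * s k)))) 
          * ennreal (exp (- (?c * s r)))"
        using prob_clock[of r s] s 2 c by (simp add: emeasure_eq_measure emeasure_exponential_greaterThan)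
      also have "\<dots> = ennreal ((\<Prod>k<r. p (Suc k)) * (\<Prod>k\<le>r. exp (- (l (Suc k) * s k))) * exp (- (?c * s r)))"
        by (rule ennreal_mult''[symmetric]) simp
      also have "(\<Prod>k<r. p (Suc k)) * (\<Prod>k\<le>r. exp (- (l (Suc k) * s k))) * exp (- (?c * s r))
          = (\<Prod>k<j. p' (Suc k)) * (\<Prod>k\<le>j. exp (- (l' (Suc k) * s k)))"
        using 2 by (simp add: l'_def p'_def lessThan_Suc_atMost[symmetric] mult.assoc exp_add[symmetric])
      finally show ?thesis .
    next
      case 3
      \<comment> \<open>Varying only the threshold at index r in \<open>prob_clock\<close> gives the
        exponential tail of \<open>S r\<close> jointly with the history \<open>?P\<close>, as the
        race lemma requires.\<close>
      let ?P = "\<lambda>\<omega>. r < K \<omega> \<and> (\<forall>k<r. s k < S k \<omega>)"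
      let ?A = "(\<Prod>k<r. p (Suc k)) * (\<Prod>k<r. exp (- (l (Suc k) * s k)))"
      have tail: "prob {\<omega> \<in> space M. ?P \<omega> \<and> t < S r \<omega>} = ?A * exp (- (?c * t))" if "0 \<le> t" for t
      proof -
        have "{\<omega> \<in> space M. ?P \<omega> \<and> t < S r \<omega>} =
            {\<omega> \<in> space M. r < K \<omega> \<and> (\<forall>k\<le>r. (s(r := t)) k < S k \<omega>)}"
          by (auto simp: le_less)
        then show ?thesis
          using prob_clock[of r "s(r := t)"] s that 3 by (simp add: lessThan_Suc_atMost[symmetric])
      qed
      have "?E = {z \<in> space N. s r < snd z \<and> ?P (fst z) \<and> snd z + s (Suc r) < S r (fst z)}"
      proof (rule Collect_cong, rule conj_cong[OF refl])
        fix z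
        assume "z \<in> space N"
        have "0 \<le> s (Suc r)" using s 3 by simp
        then show "(j < K' z \<and> (\<forall>k\<le>j. s k < S' k z)) \<longleftrightarrow>
          (s r < snd z \<and> ?P (fst z) \<and> snd z + s (Suc r) < S r (fst z))"
          using 3 by (auto simp: K'_def S'_def le_Suc_eq le_less)
      qed
      moreover have "emeasure (M \<Otimes>\<^sub>M exponential ?c)
          {z \<in> space (M \<Otimes>\<^sub>M exponential ?c).
            s r < snd z \<and> ?P (fst z) \<and> snd z + s (Suc r) < S r (fst z)}
          = ennreal (?A / 2 * exp (- (?c * s (Suc r))) * exp (- (2 * ?c * s r)))"
      proof (rule emeasure_exponential_race[OF _ _ c _ _ tail])
        show "0 \<le> s r" "0 \<le> s (Suc r)" using s 3 by simp_all
      qed measurable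
      ultimately have "emeasure N ?E = ennreal (?A / 2 * exp (- (?c * s (Suc r))) * exp (- (2 * ?c * s r)))"
        unfolding N_def by (simp only:)
      also have "?A / 2 * exp (- (?c * s (Suc r))) * exp (- (2 * ?c * s r)) =
          (\<Prod>k<j. p' (Suc k)) * (\<Prod>k\<le>j. exp (- (l' (Suc k) * s k)))"
        using 3 by (simp add: l'_def p'_def lessThan_Suc_atMost[symmetric])
      finally show ?thesis .
    qed
    \<comment> \<open>\<open>ennreal\<close> truncates negative numbers to 0, so nonnegativity is
      what allows the return from \<open>emeasure\<close> to \<open>measure\<close>.\<close>
    moreover have "0 \<le> (\<Prod>k<j. p' (Suc k)) * (\<Prod>k\<le>j. exp (- (l' (Suc k) * s k)))"
      using p by (intro mult_nonneg_nonneg prod_nonneg) (use j in \<open>auto simp: p'_def\<close>)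
    ultimately show "measure N ?E = (\<Prod>k<j. p' (Suc k)) * (\<Prod>k\<le>j. exp (- (l' (Suc k) * s k)))"
      by (simp add: measure_def)
  qed measurable
  moreover have "distr N borel (\<lambda>z. \<Sum>k<K' z. S' k z) = distr M borel (\<lambda>\<omega>. \<Sum>k<K \<omega>. S k \<omega>)"
  proof -
    interpret N': coxian_clock N "Suc (Suc r)" l' p' K' S' by fact
    have "AE z in N. N'.total z = total (fst z)"
      using AE_fst
    proof eventually_elim
      case (elim z)
      then consider "K (fst z) \<le> r" | "K (fst z) = Suc r" by linarith
      then show ?case
        by cases (auto simp: N'.total_def total_def K'_def S'_def)
    qed
    then have "distr N borel N'.total = distr N borel (\<lambda>z. total (fst z))"
    proof (intro distr_cong_AE)
      show "N'.total \<in> borel_measurable N" by measurable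
      show "(\<lambda>z. total (fst z)) \<in> borel_measurable N" unfolding N_def by measurable
    qed auto
    also have "\<dots> = distr (distr N M fst) borel total"
      unfolding N_def by (subst distr_distr) (auto simp: comp_def)
    also have "distr N M fst = M"
      unfolding N_def by (rule E.distr_pair_fst)
    finally show ?thesis by (simp add: N'.total_def total_def)
  qed
  ultimately show ?thesis by blast
qed

section \<open>Coxian laws on a fixed sample space and their extension to size n\<close>

text \<open>The type of the sample space is the one fixed in \<open>phase_type\<close>. Splitting
  enlarges the sample space by a real coordinate, so an iteration has to return to this type after
  each step.\<close>

definition coxian_law ::
  "nat \<Rightarrow> (nat \<Rightarrow> real) \<Rightarrow> (nat \<Rightarrow> real) \<Rightarrow> real measure \<Rightarrow> bool" where
  "coxian_law n l p \<mu> \<longleftrightarrow>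
     (\<exists>(M :: ((nat \<Rightarrow> nat) \<times> (nat \<Rightarrow> real)) measure) K S.
        coxian_clock M n l p K S \<and> \<mu> = distr M borel (\<lambda>\<omega>. \<Sum>k<K \<omega>. S k \<omega>))"

text \<open>Both the clock conditions and the law of the total time depend only on the joint
  distribution of K and the holding times, so they survive the image measure under the map that
  records these.\<close>

lemma coxian_law_if_clock:
  fixes M :: "'w measure"
  assumes "coxian_clock M n l p K S"
  shows "coxian_law n l p (distr M borel (\<lambda>\<omega>. \<Sum>k<K \<omega>. S k \<omega>))"
proof -
  interpret coxian_clock M n l p K S by fact
  let ?R = "Pi\<^sub>M UNIV (\<lambda>_ :: nat. count_space (UNIV :: nat set))
    \<Otimes>\<^sub>M Pi\<^sub>M UNIV (\<lambda>_ :: nat. borel :: real measure)"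
  \<comment> \<open>The first component of the target type is a sequence, so K is stored as a
    constant sequence and read off at 0.\<close>
  define f where "f = (\<lambda>\<omega>. (\<lambda>_ :: nat. K \<omega>, \<lambda>k. S k \<omega>))"
  define K' :: "(nat \<Rightarrow> nat) \<times> (nat \<Rightarrow> real) \<Rightarrow> nat" where "K' w = fst w 0" for w
  define S' :: "nat \<Rightarrow> (nat \<Rightarrow> nat) \<times> (nat \<Rightarrow> real) \<Rightarrow> real" where "S' k w = snd w k" for k w
  have [measurable]: "f \<in> M \<rightarrow>\<^sub>M ?R"
    unfolding f_def by (intro measurable_Pair measurable_PiM_single') auto
  have [measurable]: "K' \<in> ?R \<rightarrow>\<^sub>M count_space UNIV" "S' k \<in> borel_measurable ?R" for k
    unfolding K'_def S'_def by measurable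
  have [simp]: "K' (f \<omega>) = K \<omega>" "S' k (f \<omega>) = S k \<omega>" for k \<omega>
    by (simp_all add: K'_def S'_def f_def)
  have "coxian_clock (distr M ?R f) n l p K' S'"
  proof (intro coxian_clock.intro coxian_clock_axioms.intro)
    show "prob_space (distr M ?R f)" by (rule prob_space_distr) measurable
    show "AE w in distr M ?R f. 0 < K' w \<and> K' w \<le> n \<and> (\<forall>k<K' w. 0 < S' k w)"
      using AE_clock by (subst AE_distr_iff) simp_all
  next
    fix j and s :: "nat \<Rightarrow> real"
    assume js: "j < n" "\<And>k. k \<le> j \<Longrightarrow> 0 \<le> s k"
    have "measure (distr M ?R f) {w \<in> space (distr M ?R f). j < K' w \<and> (\<forall>k\<le>j. s k < S' k w)}
      = prob (f -` {w \<in> space ?R. j < K' w \<and> (\<forall>k\<le>j. s k < S' k w)} \<inter> space M)"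
      by (simp add: measure_distr)
    also have "f -` {w \<in> space ?R. j < K' w \<and> (\<forall>k\<le>j. s k < S' k w)} \<inter> space M
      = {\<omega> \<in> space M. j < K \<omega> \<and> (\<forall>k\<le>j. s k < S k \<omega>)}"
      using measurable_space[OF \<open>f \<in> M \<rightarrow>\<^sub>M ?R\<close>] by auto
    finally show "measure (distr M ?R f) {w \<in> space (distr M ?R f). j < K' w \<and> (\<forall>k\<le>j. s k < S' k w)}
      = (\<Prod>k<j. p (Suc k)) * (\<Prod>k\<le>j. exp (- (l (Suc k) * s k)))"
      using prob_clock[OF js] by simp
  qed measurable
  moreover have "distr M borel (\<lambda>\<omega>. \<Sum>k<K \<omega>. S k \<omega>)
      = distr (distr M ?R f) borel (\<lambda>w. \<Sum>k<K' w. S' k w)"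
  proof -
    interpret R: coxian_clock "distr M ?R f" n l p K' S' by fact
    have "R.total \<in> borel_measurable ?R" using R.measurable_total by simp
    then show ?thesis
      using distr_distr[of R.total ?R borel f M] by (simp add: R.total_def comp_def)
  qed
  ultimately show ?thesis unfolding coxian_law_def by blast
qed

text \<open>Allows the parameters to be made \<open>undefined\<close> outside their index sets, as
  membership in \<open>coxian_parameters\<close> demands.\<close>

lemma coxian_law_cong:
  assumes "coxian_law n l p \<mu>" "\<And>i. i \<in> {1..n} \<Longrightarrow> l i = l' i" "\<And>i. i \<in> {1..<n} \<Longrightarrow> p i = p' i"
  shows "coxian_law n l' p' \<mu>"
proof -
  have "(\<Prod>k<j. p (Suc k)) * (\<Prod>k\<le>j. exp (- (l (Suc k) * s k)))
      = (\<Prod>k<j. p' (Suc k)) * (\<Prod>k\<le>j. exp (- (l' (Suc k) * s k)))" if "j < n" for j s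
    using that assms by (intro arg_cong2[where f = "(*)"] prod.cong) auto
  then have "coxian_clock M n l p K S \<Longrightarrow> coxian_clock M n l' p' K S"
    for M :: "((nat \<Rightarrow> nat) \<times> (nat \<Rightarrow> real)) measure" and K S
    by (auto simp: coxian_clock_def coxian_clock_axioms_def)
  with assms(1) show ?thesis unfolding coxian_law_def by blast
qed

lemma coxian_law_split:
  assumes "coxian_law (Suc r) l p \<mu>" "0 < l (Suc r)" "\<And>k. k < r \<Longrightarrow> 0 \<le> p (Suc k)"
  shows "coxian_law (Suc (Suc r)) (l(Suc r := 2 * l (Suc r), Suc (Suc r) := l (Suc r)))
    (p(Suc r := 1 / 2)) \<mu>"
proof -
  obtain M :: "((nat \<Rightarrow> nat) \<times> (nat \<Rightarrow> real)) measure" and K S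
    where clock: "coxian_clock M (Suc r) l p K S"
      and \<mu>: "\<mu> = distr M borel (\<lambda>\<omega>. \<Sum>k<K \<omega>. S k \<omega>)"
    using assms(1) unfolding coxian_law_def by blast
  let ?l = "l(Suc r := 2 * l (Suc r), Suc (Suc r) := l (Suc r))" and ?p = "p(Suc r := 1 / 2)"
  obtain K' S' where
    clock': "coxian_clock (M \<Otimes>\<^sub>M exponential (l (Suc r))) (Suc (Suc r)) ?l ?p K' S'"
    and \<mu>': "distr (M \<Otimes>\<^sub>M exponential (l (Suc r))) borel (\<lambda>z. \<Sum>k<K' z. S' k z) = \<mu>"
    using coxian_clock_split[OF clock assms(2,3)] unfolding \<mu> by blast
  from coxian_law_if_clock[OF clock'] show ?thesis unfolding \<mu>' .
qed

text \<open>Each step splits the current last state. The only new routing probability is 1/2, so all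
  of them stay strictly between 0 and 1.\<close>

lemma coxian_law_extend:
  assumes "coxian_law m l p \<mu>" "1 \<le> m" "m \<le> n"
    and "\<And>i. i \<in> {1..m} \<Longrightarrow> 0 < l i" "\<And>i. i \<in> {1..<m} \<Longrightarrow> p i \<in> {0<..<1}"
  shows "\<exists>l' p'. coxian_law n l' p' \<mu> \<and> (\<forall>i\<in>{1..n}. 0 < l' i) \<and> (\<forall>i\<in>{1..<n}. p' i \<in> {0<..<1})"
  using \<open>m \<le> n\<close>
proof (induction n rule: dec_induct)
  case base
  then show ?case using assms by blast
next
  case (step n)
  then obtain l' p' where IH: "coxian_law n l' p' \<mu>"
    "\<And>i. i \<in> {1..n} \<Longrightarrow> 0 < l' i" "\<And>i. i \<in> {1..<n} \<Longrightarrow> p' i \<in> {0<..<1}" by blast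
  obtain r where r: "n = Suc r" using \<open>1 \<le> m\<close> step.hyps by (cases n) auto
  have p': "0 \<le> p' (Suc k)" if "k < r" for k using IH(3)[of "Suc k"] r that by simp
  let ?l = "l'(n := 2 * l' n, Suc n := l' n)" and ?p = "p'(n := 1 / 2)"
  have "coxian_law (Suc n) ?l ?p \<mu>"
    using coxian_law_split[of r l' p' \<mu>] IH p' r by simp
  moreover have "\<forall>i\<in>{1..Suc n}. 0 < ?l i" using IH(2) r by (auto simp: le_Suc_eq)
  moreover have "\<forall>i\<in>{1..<Suc n}. ?p i \<in> {0<..<1}"
    using IH(3) by (auto simp: less_Suc_eq)
  ultimately show ?case by blast
qed

lemma phase_type_if_coxian_law:
  assumes "coxian_law n l p \<mu>" "1 \<le> n" and l: "\<And>i. i \<in> {1..n} \<Longrightarrow> 0 < l i"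
  shows "phase_type n coxian_initial (coxian_subgenerator (l, p)) \<mu>"
proof -
  obtain M :: "((nat \<Rightarrow> nat) \<times> (nat \<Rightarrow> real)) measure" and K S
    where clock: "coxian_clock M n l p K S"
      and \<mu>: "\<mu> = distr M borel (\<lambda>\<omega>. \<Sum>k<K \<omega>. S k \<omega>)"
    using assms(1) unfolding coxian_law_def by blast
  have "absorption_time 0 (\<lambda>k \<omega>. coxian_path (K \<omega>) k) S = (\<lambda>\<omega>. \<Sum>k<K \<omega>. S k \<omega>)"
    by (simp add: absorption_time_def Least_coxian_path fun_eq_iff)
  with coxian_clock.ctmc_coxian_path[OF clock l \<open>1 \<le> n\<close>] \<mu> show ?thesis
    unfolding phase_type_def by metis
qed

section \<open>The image of the parametrization and the equality of laws\<close>

lemma sigmoid_bounds: "sigmoid z \<in> {0<..<1}"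
  by (simp add: sigmoid_def divide_simps add_pos_pos)

lemma sigmoid_logit:
  assumes "0 < x" "x < 1"
  shows "sigmoid (ln (x / (1 - x))) = x"
  using assms by (simp add: sigmoid_def exp_minus divide_simps)

lemma phi_image:
  "phi n ` phi_domain n = {(l, p) \<in> coxian_parameters n. \<forall>j\<in>{1..<n}. p j \<noteq> 0}" (is "_ = ?R")
proof (intro equalityI subsetI)
  fix \<theta> assume "\<theta> \<in> phi n ` phi_domain n"
  then obtain g u where gu: "g \<in> {1..n} \<rightarrow>\<^sub>E UNIV - {0}" "\<theta> = phi n (g, u)"
    by (auto simp: phi_domain_def)
  have "sigmoid (u j) < 1" "0 < sigmoid (u j)" for j using sigmoid_bounds[of "u j"] by auto
  moreover have "0 < (g j)\<^sup>2" if "j \<in> {1..n}" for j using PiE_mem[OF gu(1) that] by simp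
  ultimately show "\<theta> \<in> ?R"
    by (auto simp: gu(2) phi_def coxian_parameters_def less_imp_le less_imp_neq[THEN not_sym])
next
  fix \<theta> assume "\<theta> \<in> ?R"
  then obtain l p where \<theta>: "\<theta> = (l, p)" and l: "l \<in> {1..n} \<rightarrow>\<^sub>E {0<..}"
    and p: "p \<in> {1..<n} \<rightarrow>\<^sub>E {0..<1}" "\<And>j. j \<in> {1..<n} \<Longrightarrow> p j \<noteq> 0"
    by (auto simp: coxian_parameters_def)
  \<comment> \<open>Square root and logit invert the two components of \<open>phi\<close>; the logit
    is where p j > 0 is needed.\<close>
  let ?g = "\<lambda>j\<in>{1..n}. sqrt (l j)" and ?u = "\<lambda>j\<in>{1..<n}. ln (p j / (1 - p j))"
  have l_pos: "0 < l j" if "j \<in> {1..n}" for j using PiE_mem[OF l that] by simp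
  have p_bounds: "0 < p j" "p j < 1" if "j \<in> {1..<n}" for j
    using PiE_mem[OF p(1) that] p(2)[OF that] by auto
  have "(?g, ?u) \<in> phi_domain n"
    using l_pos by (fastforce simp: phi_domain_def)
  moreover have "phi n (?g, ?u) = (l, p)"
  proof -
    have "(\<lambda>j\<in>{1..n}. (?g j)\<^sup>2) = l"
      by (rule PiE_ext[OF _ l]) (use l_pos in \<open>auto simp: less_imp_le\<close>)
    moreover have "(\<lambda>j\<in>{1..<n}. sigmoid (?u j)) = p"
      by (rule PiE_ext[OF _ p(1)]) (use p_bounds in \<open>auto simp: sigmoid_logit less_imp_le\<close>)
    ultimately show ?thesis by (simp add: phi_def)
  qed
  ultimately show "\<theta> \<in> phi n ` phi_domain n" unfolding \<theta> by (intro image_eqI[where x = "(?g, ?u)"]) auto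
qed

lemma phase_type_coxian_nonzero:
  assumes "1 \<le> n" "\<theta> \<in> coxian_parameters n"
    and "phase_type n coxian_initial (coxian_subgenerator \<theta>) \<mu>"
  shows "\<exists>\<theta>'\<in>phi n ` phi_domain n. phase_type n coxian_initial (coxian_subgenerator \<theta>') \<mu>"
proof -
  obtain l p where \<theta>: "\<theta> = (l, p)" and lE: "l \<in> {1..n} \<rightarrow>\<^sub>E {0<..}" and pE: "p \<in> {1..<n} \<rightarrow>\<^sub>E {0..<1}"
    using assms(2) by (auto simp: coxian_parameters_def)
  have l: "0 < l j" if "j \<in> {1..n}" for j using PiE_mem[OF lE that] by simp
  obtain M :: "((nat \<Rightarrow> nat) \<times> (nat \<Rightarrow> real)) measure" and Y S
    where ctmc: "ctmc M {0..n} (full_initial n coxian_initial) (coxian_generator n l p) Y S"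
      and \<mu>: "\<mu> = distr M borel (absorption_time 0 Y S)"
    using assms(3) unfolding phase_type_def \<theta> by blast
  \<comment> \<open>This is the first state that the chain cannot leave towards a further transient
    state. The alternative j = n guarantees that the minimum exists, and below m no p is 0.\<close>
  define m where "m = (LEAST j. 1 \<le> j \<and> (j = n \<or> p j = 0))"
  have m: "1 \<le> m" "m = n \<or> p m = 0" "m \<le> n"
    using LeastI[of "\<lambda>j. 1 \<le> j \<and> (j = n \<or> p j = 0)" n]
      Least_le[of "\<lambda>j. 1 \<le> j \<and> (j = n \<or> p j = 0)" n] assms(1) by (auto simp: m_def)
  have p: "p i \<in> {0<..<1}" if "i \<in> {1..<m}" for i
  proof -
    have "p i \<noteq> 0" using not_less_Least[of i "\<lambda>j. 1 \<le> j \<and> (j = n \<or> p j = 0)"] that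
      by (auto simp: m_def)
    with PiE_mem[OF pE, of i] that m show ?thesis by auto
  qed
  have law_m: "coxian_law m l p \<mu>"
    using coxian_law_if_clock[OF coxian_clock_if_ctmc[OF ctmc l m(1,3)]] m(2)
    by (auto simp: \<mu> absorption_time_def[abs_def])
  have l_m: "0 < l i" if "i \<in> {1..m}" for i using l that m(3) by auto
  obtain l' p' where law: "coxian_law n l' p' \<mu>"
    and l': "\<And>i. i \<in> {1..n} \<Longrightarrow> 0 < l' i" and p': "\<And>i. i \<in> {1..<n} \<Longrightarrow> p' i \<in> {0<..<1}"
    using coxian_law_extend[OF law_m m(1,3) l_m p] by blast
  let ?l = "restrict l' {1..n}" and ?p = "restrict p' {1..<n}"
  have "coxian_law n ?l ?p \<mu>" by (rule coxian_law_cong[OF law]) auto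
  then have "phase_type n coxian_initial (coxian_subgenerator (?l, ?p)) \<mu>"
    by (rule phase_type_if_coxian_law) (use assms(1) l' in auto)
  moreover have "(?l, ?p) \<in> phi n ` phi_domain n"
    unfolding phi_image coxian_parameters_def using l' p' by (fastforce simp: less_imp_le)
  ultimately show ?thesis by blast
qed

text \<open>Surjectivity is an equality of sets of laws. It cannot be one of parameter sets for n
  \<ge> 2, where the image of \<open>phi\<close> is a proper subset of
  \<open>coxian_parameters n\<close>; the second conjunct records which subset.\<close>

theorem proposition2:
  fixes n :: nat
  assumes "1 \<le> n"
  shows "coxian_laws n (phi n ` phi_domain n) = coxian_distributions n
    \<and> phi n ` phi_domain n = {(l, p) \<in> coxian_parameters n. \<forall>j\<in>{1..<n}. p j \<noteq> 0}"
proof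
  show "coxian_laws n (phi n ` phi_domain n) = coxian_distributions n"
  proof
    show "coxian_laws n (phi n ` phi_domain n) \<subseteq> coxian_distributions n"
      unfolding phi_image by (auto simp: coxian_laws_def coxian_distributions_def)
    show "coxian_distributions n \<subseteq> coxian_laws n (phi n ` phi_domain n)"
      using phase_type_coxian_nonzero[OF assms]
      by (auto simp: coxian_laws_def coxian_distributions_def)
  qed
qed (rule phi_image)

end
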